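(* Let $G$ be a finite simple connected graph of order $n\ge 5$ and size $m$. If $G$ has a perfect matching, then $\chi'_L(G)\le m-\frac{n}{2}+1$. This bound is attained by the cycle $C_6$ and the path $P_6$.
   Context: $C_6$ and $P_6$ are the cycle and path on six vertices. For a proper edge coloring $c:E(G)\to\{1,\dots,k\}$ of $G$, let $\pi=(\mathcal{C}_1,\dots,\mathcal{C}_k)$ be the ordered partition of $E(G)$ into color classes. For a vertex $v$ and an edge $e=xy$, $d(v,e)=\min\{d(v,x),d(v,y)\}$, and $d(v,\mathcal{C}_i)=\min\{d(v,e): e\in\mathcal{C}_i\}$. The edge color code of $v$ is $c_\pi(v)=(d(v,\mathcal{C}_1),\dots,d(v,\mathcal{C}_k))$. The coloring is an edge-locating coloring if distinct vertices have distinct edge color codes; $\chi'_L(G)$ is the minimum number of colors in an edge-locating coloring of $G$. *)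

theory Defs
  imports Complex_Main "HOL-Library.Extended_Nat" "HOL-Library.Extended_Real"
begin

type_synonym 'a graph = "'a set \<times> 'a set set"

abbreviation verts :: "'a graph \<Rightarrow> 'a set" where
  "verts G \<equiv> fst G"

abbreviation edges :: "'a graph \<Rightarrow> 'a set set" where
  "edges G \<equiv> snd G"

definition fin_simple_graph :: "'a graph \<Rightarrow> bool" where
  "fin_simple_graph G \<longleftrightarrow> finite (verts G) \<and> (\<forall>e\<in>edges G. e \<subseteq> verts G \<and> card e = 2)"

definition graph_order :: "'a graph \<Rightarrow> nat" where
  "graph_order G = card (verts G)"

definition graph_size :: "'a graph \<Rightarrow> nat" where
  "graph_size G = card (edges G)"

definition walk_betw :: "'a graph \<Rightarrow> 'a \<Rightarrow> 'a list \<Rightarrow> 'a \<Rightarrow> bool" where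
  "walk_betw G u p v \<longleftrightarrow>
     p \<noteq> [] \<and> set p \<subseteq> verts G \<and> hd p = u \<and> last p = v \<and>
     successively (\<lambda>x y. {x, y} \<in> edges G) p"

definition connected_graph :: "'a graph \<Rightarrow> bool" where
  "connected_graph G \<longleftrightarrow>
     verts G \<noteq> {} \<and> (\<forall>u\<in>verts G. \<forall>v\<in>verts G. \<exists>p. walk_betw G u p v)"

definition perfect_matching :: "'a graph \<Rightarrow> 'a set set \<Rightarrow> bool" where
  "perfect_matching G M \<longleftrightarrow> M \<subseteq> edges G \<and> (\<forall>v\<in>verts G. \<exists>!e. e \<in> M \<and> v \<in> e)"

(* Minima are taken as infima in the extended naturals: the infimum of a nonempty set
   is attained, and the infimum of the empty set is infinity. *)

definition vdist :: "'a graph \<Rightarrow> 'a \<Rightarrow> 'a \<Rightarrow> enat" where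
  "vdist G u v = Inf {enat (length p - 1) | p. walk_betw G u p v}"

definition edge_dist :: "'a graph \<Rightarrow> 'a \<Rightarrow> 'a set \<Rightarrow> enat" where
  "edge_dist G v e = (INF x\<in>e. vdist G v x)"

definition class_dist :: "'a graph \<Rightarrow> 'a \<Rightarrow> 'a set set \<Rightarrow> enat" where
  "class_dist G v C = (INF e\<in>C. edge_dist G v e)"

(* Every one of the k colors is used, so that the color classes form a partition of the
   edge set into k nonempty parts. *)
definition proper_edge_coloring :: "'a graph \<Rightarrow> nat \<Rightarrow> ('a set \<Rightarrow> nat) \<Rightarrow> bool" where
  "proper_edge_coloring G k c \<longleftrightarrow>
     c ` edges G = {1..k} \<and>
     (\<forall>e\<in>edges G. \<forall>f\<in>edges G. e \<noteq> f \<and> e \<inter> f \<noteq> {} \<longrightarrow> c e \<noteq> c f)"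

definition color_class :: "'a graph \<Rightarrow> ('a set \<Rightarrow> nat) \<Rightarrow> nat \<Rightarrow> 'a set set" where
  "color_class G c i = {e \<in> edges G. c e = i}"

definition edge_color_code :: "'a graph \<Rightarrow> nat \<Rightarrow> ('a set \<Rightarrow> nat) \<Rightarrow> 'a \<Rightarrow> enat list" where
  "edge_color_code G k c v = map (\<lambda>i. class_dist G v (color_class G c i)) [1..<Suc k]"

definition edge_locating_coloring :: "'a graph \<Rightarrow> nat \<Rightarrow> ('a set \<Rightarrow> nat) \<Rightarrow> bool" where
  "edge_locating_coloring G k c \<longleftrightarrow>
     proper_edge_coloring G k c \<and> inj_on (edge_color_code G k c) (verts G)"

(* Infinity if there is no edge-locating coloring (e.g. for the single-edge graph), so a
   finite upper bound includes the existence of one. *)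
definition edge_locating_chromatic_number :: "'a graph \<Rightarrow> enat" where
  "edge_locating_chromatic_number G = Inf {enat k | k. \<exists>c. edge_locating_coloring G k c}"

(* Intended for n \<ge> 3. *)
definition cycle_graph :: "nat \<Rightarrow> nat graph" where
  "cycle_graph n = ({..<n}, {{i, (i + 1) mod n} | i. i < n})"

definition path_graph :: "nat \<Rightarrow> nat graph" where
  "path_graph n = ({..<n}, {{i, i + 1} | i. i + 1 < n})"

end

theory Submission
  imports Defs
begin

text \<open>Colour a perfect matching with one colour and give every other edge a colour of its own. If two
  distinct vertices \<open>u\<close>, \<open>v\<close> had the same code, then they would be within distance 0, and within
  distance 1, of the same non-matching edges. This forces the set consisting of \<open>u\<close>, \<open>v\<close> and their
  partners in the matching to be closed under adjacency, so by connectedness the graph would have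
  at most four vertices. For sharpness, distances 0 and 1 suffice as well: with too few
  colours on \<open>C\<^sub>6\<close> or \<open>P\<^sub>6\<close>, two vertices see the same colours and are within distance 1 of all
  colours.\<close>

section \<open>Distances below 1 and below 2, and equality of codes\<close>

text \<open>Strict thresholds suit infima: \<open>Inf_less_iff\<close> turns them into the existence
  of a short walk, without a separate argument that the minimum is attained.\<close>

lemma vdist_less_1_iff:
  "vdist G u v < 1 \<longleftrightarrow> u = v \<and> u \<in> verts G"
proof
  assume "vdist G u v < 1"
  then obtain p where p: "walk_betw G u p v" "enat (length p - 1) < 1"
    unfolding vdist_def Inf_less_iff by blast
  then have "length p = 1"
    by (cases p) (auto simp: walk_betw_def one_enat_def)
  then show "u = v \<and> u \<in> verts G"
    using p(1) by (auto simp: walk_betw_def length_Suc_conv)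
next
  assume "u = v \<and> u \<in> verts G"
  then have "walk_betw G u [u] v"
    by (auto simp: walk_betw_def)
  then show "vdist G u v < 1"
    unfolding vdist_def Inf_less_iff by (force simp: one_enat_def)
qed

lemma vdist_less_2_iff:
  "vdist G u v < 2 \<longleftrightarrow> u \<in> verts G \<and> v \<in> verts G \<and> (u = v \<or> {u, v} \<in> edges G)"
proof
  assume "vdist G u v < 2"
  then obtain p where p: "walk_betw G u p v" "enat (length p - 1) < 2"
    unfolding vdist_def Inf_less_iff by blast
  then have "p \<noteq> []" "length p - 1 < 2"
    by (auto simp: walk_betw_def numeral_eq_enat)
  then have "length p = 1 \<or> length p = 2"
    \<comment> \<open>\<open>remdups_adj.cases\<close> serves only as the split into empty,
      one-element and longer lists.\<close>
    by (cases p rule: remdups_adj.cases) auto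
  then show "u \<in> verts G \<and> v \<in> verts G \<and> (u = v \<or> {u, v} \<in> edges G)"
    using p(1) by (auto simp: walk_betw_def length_Suc_conv numeral_2_eq_2)
next
  assume "u \<in> verts G \<and> v \<in> verts G \<and> (u = v \<or> {u, v} \<in> edges G)"
  then have "\<exists>p. walk_betw G u p v \<and> length p - 1 < 2"
    by (force simp: walk_betw_def intro: exI[of _ "[u]"] exI[of _ "[u, v]"])
  then show "vdist G u v < 2"
    unfolding vdist_def Inf_less_iff by (force simp: numeral_eq_enat)
qed

lemma class_dist_less_1_iff:
  assumes "v \<in> verts G"
  shows "class_dist G v C < 1 \<longleftrightarrow> (\<exists>e\<in>C. v \<in> e)"
  using assms by (auto simp: class_dist_def edge_dist_def INF_less_iff vdist_less_1_iff)

lemma class_dist_less_2_iff: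
  assumes "v \<in> verts G" "\<Union>C \<subseteq> verts G"
  shows "class_dist G v C < 2 \<longleftrightarrow> (\<exists>e\<in>C. v \<in> e \<or> (\<exists>x\<in>e. {v, x} \<in> edges G))"
  using assms by (auto simp: class_dist_def edge_dist_def INF_less_iff vdist_less_2_iff)

text \<open>Only 0 and 1 lie below 2. Two code entries in this range therefore agree as soon as they
  agree on being 0, that is, on incidence with the colour.\<close>

lemma enat_eq_of_less_2:
  fixes a b :: enat
  assumes "a < 2" "b < 2" "a < 1 \<longleftrightarrow> b < 1"
  shows "a = b"
  using assms by (cases a; cases b) (auto simp: one_enat_def numeral_eq_enat)

lemma edge_color_code_eq_iff:
  "edge_color_code G k c u = edge_color_code G k c v \<longleftrightarrow>
    (\<forall>i\<in>{1..k}. class_dist G u (color_class G c i) = class_dist G v (color_class G c i))"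
  by (auto simp: edge_color_code_def)

section \<open>Finiteness, connectedness and perfect matchings\<close>

lemma finite_edges:
  assumes "fin_simple_graph G"
  shows "finite (edges G)"
proof (rule finite_subset)
  show "edges G \<subseteq> Pow (verts G)" "finite (Pow (verts G))"
    using assms by (auto simp: fin_simple_graph_def)
qed

text \<open>A walk that starts in \<open>S\<close> never leaves it, and connectedness provides a
  walk from \<open>u\<close> to every vertex.\<close>

lemma connected_closed_eq:
  assumes conn: "connected_graph G" and "u \<in> S" "u \<in> verts G"
    and closed: "\<And>x y. x \<in> S \<Longrightarrow> {x, y} \<in> edges G \<Longrightarrow> y \<in> S"
  shows "verts G \<subseteq> S"
proof
  fix v assume "v \<in> verts G"
  then obtain p where p: "walk_betw G u p v"
    using conn \<open>u \<in> verts G\<close> by (auto simp: connected_graph_def)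
  have "set p \<subseteq> S" if "successively (\<lambda>x y. {x, y} \<in> edges G) p" "hd p \<in> S" for p
    using that
  proof (induction p)
    case (Cons x p)
    then show ?case using closed by (cases p) auto
  qed simp
  then show "v \<in> S"
    using p \<open>u \<in> S\<close> by (metis last_in_set subsetD walk_betw_def)
qed

lemma perfect_matchingI:
  assumes "M \<subseteq> edges G" "verts G \<subseteq> \<Union>M" "pairwise disjnt M"
  shows "perfect_matching G M"
  unfolding perfect_matching_def
proof (intro conjI ballI)
  fix v assume "v \<in> verts G"
  then obtain e where e: "e \<in> M" "v \<in> e"
    using assms(2) by auto
  then show "\<exists>!e. e \<in> M \<and> v \<in> e"
    using assms(3) by (intro ex1I[of _ e]) (auto simp: pairwise_def disjnt_iff)
qed fact

lemma perfect_matching_partner: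
  assumes "fin_simple_graph G" "perfect_matching G M" "v \<in> verts G"
  obtains w where "{v, w} \<in> M" "v \<noteq> w"
proof -
  obtain e where e: "e \<in> M" "v \<in> e"
    using assms by (metis perfect_matching_def)
  then have "card e = 2"
    using assms by (auto simp: fin_simple_graph_def perfect_matching_def)
  then show thesis
    using e that by (auto simp: card_2_iff insert_commute)
qed

lemma perfect_matching_disjoint:
  assumes "fin_simple_graph G" "perfect_matching G M" "e \<in> M" "f \<in> M" "v \<in> e" "v \<in> f"
  shows "e = f"
proof -
  have "v \<in> verts G"
    using assms by (auto simp: fin_simple_graph_def perfect_matching_def)
  then show ?thesis
    using assms by (auto simp: perfect_matching_def)
qed

lemma card_perfect_matching:
  assumes "fin_simple_graph G" "perfect_matching G M"
  shows "2 * card M = graph_order G"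
proof -
  have M: "\<And>e. e \<in> M \<Longrightarrow> e \<subseteq> verts G \<and> card e = 2" and fin: "finite (verts G)"
    using assms by (auto simp: fin_simple_graph_def perfect_matching_def)
  have "\<Union>M = verts G"
    using M assms(2) by (auto simp: perfect_matching_def)
  moreover have "finite M"
    using M fin by (meson PowI finite_Pow_iff finite_subset subsetI)
  ultimately show ?thesis
    unfolding graph_order_def
    using card_partition[of M 2] M fin perfect_matching_disjoint[OF assms]
    by (metis disjoint_iff)
qed

section \<open>The upper bound\<close>

text \<open>By \<open>zero\<close>, a non-matching edge at \<open>u\<close> also contains
  \<open>v\<close>, so \<open>u\<close> has no neighbours besides \<open>v\<close> and its partner
  \<open>u'\<close>; likewise for \<open>v\<close>. A non-matching edge \<open>{u', y}\<close> is
  near \<open>u\<close> through \<open>u'\<close>, hence near \<open>v\<close> by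
  \<open>near\<close>, and the few neighbours of \<open>v\<close> then leave no \<open>y\<close>
  outside \<open>{u, v, u', v'}\<close>.\<close>

lemma matching_twins_order_le_4:
  assumes G: "fin_simple_graph G" and conn: "connected_graph G" and M: "perfect_matching G M"
    and uv: "u \<in> verts G" "v \<in> verts G" "u \<noteq> v"
    and zero: "\<And>f. f \<in> edges G - M \<Longrightarrow> u \<in> f \<longleftrightarrow> v \<in> f"
    and near: "\<And>f. f \<in> edges G - M \<Longrightarrow>
      (u \<in> f \<or> (\<exists>x\<in>f. {u, x} \<in> edges G)) \<longleftrightarrow> (v \<in> f \<or> (\<exists>x\<in>f. {v, x} \<in> edges G))"
  shows "graph_order G \<le> 4"
proof -
  have ME: "M \<subseteq> edges G"
    using M by (simp add: perfect_matching_def)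
  have uniq: "e = f" if "e \<in> M" "f \<in> M" "x \<in> e" "x \<in> f" for e f x
    using perfect_matching_disjoint[OF G M] that by blast
  obtain u' where u': "{u, u'} \<in> M" "u \<noteq> u'"
    using perfect_matching_partner[OF G M uv(1)] .
  obtain v' where v': "{v, v'} \<in> M" "v \<noteq> v'"
    using perfect_matching_partner[OF G M uv(2)] .
  have nbr_u: "y = v \<or> y = u'" if "{u, y} \<in> edges G" for y
    using that zero[of "{u, y}"] uniq[OF _ u'(1), of "{u, y}" u] uv(3)
    by (auto simp: doubleton_eq_iff)
  have nbr_v: "y = u \<or> y = v'" if "{v, y} \<in> edges G" for y
    using that zero[of "{v, y}"] uniq[OF _ v'(1), of "{v, y}" v] uv(3)
    by (auto simp: doubleton_eq_iff)
  let ?S = "{u, v, u', v'}"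
  have nbr_u': "y \<in> ?S" if "{u', y} \<in> edges G" for y
  proof (cases "{u', y} \<in> M \<or> u' = v")
    case True
    then show ?thesis
      using uniq[OF _ u'(1), of "{u', y}" u'] that nbr_v by (auto simp: doubleton_eq_iff)
  next
    case False
    \<comment> \<open>A common partner would make the two matching edges equal and hence
      \<open>u = v\<close>. So \<open>v\<close> is not adjacent to \<open>u'\<close>, and its
      nearness to \<open>{u', y}\<close> must come from \<open>y\<close>.\<close>
    have "u' \<noteq> v'"
      using uniq[OF u'(1) v'(1), of u'] uv(3) by (auto simp: doubleton_eq_iff)
    moreover have "v \<in> {u', y} \<or> (\<exists>x\<in>{u', y}. {v, x} \<in> edges G)"
      using near[of "{u', y}"] that False u'(1) ME by auto
    ultimately show ?thesis
      using False nbr_v u'(2) by auto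
  qed
  have nbr_v': "y \<in> ?S" if "{v', y} \<in> edges G" for y
  proof (cases "{v', y} \<in> M \<or> v' = u")
    case True
    then show ?thesis
      using uniq[OF _ v'(1), of "{v', y}" v'] that nbr_u by (auto simp: doubleton_eq_iff)
  next
    case False
    have "u' \<noteq> v'"
      using uniq[OF u'(1) v'(1), of u'] uv(3) by (auto simp: doubleton_eq_iff)
    moreover have "u \<in> {v', y} \<or> (\<exists>x\<in>{v', y}. {u, x} \<in> edges G)"
      using near[of "{v', y}"] that False v'(1) ME by auto
    ultimately show ?thesis
      using False nbr_u v'(2) by auto
  qed
  have "verts G \<subseteq> ?S"
    by (rule connected_closed_eq[OF conn _ uv(1)]) (use nbr_u nbr_v nbr_u' nbr_v' in auto)
  then have "card (verts G) \<le> card ?S"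
    by (intro card_mono) auto
  also have "\<dots> \<le> 4"
    by (auto simp: card_insert_if)
  finally show ?thesis
    by (simp add: graph_order_def)
qed

text \<open>Every colour from 2 on belongs to a single edge, so equal codes give exactly the
  hypotheses \<open>zero\<close> and \<open>near\<close> of
  \<open>matching_twins_order_le_4\<close>.\<close>

lemma edge_locating_coloring_perfect_matching:
  assumes G: "fin_simple_graph G" and conn: "connected_graph G" and order: "graph_order G \<ge> 5"
    and M: "perfect_matching G M"
  shows "\<exists>c. edge_locating_coloring G (card (edges G - M) + 1) c"
proof -
  define k where "k = card (edges G - M) + 1"
  have ME: "M \<subseteq> edges G"
    using M by (simp add: perfect_matching_def)
  have sub: "e \<subseteq> verts G" if "e \<in> edges G" for e
    using G that by (auto simp: fin_simple_graph_def)
  have "card (edges G - M) = card {2..k}"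
    by (simp add: k_def)
  then obtain h where h: "bij_betw h (edges G - M) {2..k}"
    using finite_same_card_bij[of "edges G - M" "{2..k}"] finite_edges[OF G] by blast
  \<comment> \<open>Colour 1 has to occur, since a colouring must use all of
    \<open>{1..k}\<close>.\<close>
  have "M \<noteq> {}"
    using card_perfect_matching[OF G M] order by auto
  define c where "c e = (if e \<in> M then 1 else h e)" for e
  have c_M: "c e = 1 \<longleftrightarrow> e \<in> M" if "e \<in> edges G" for e
  proof (cases "e \<in> M")
    case False
    then have "h e \<in> {2..k}"
      using that bij_betwE[OF h] by blast
    then show ?thesis
      using False by (simp add: c_def)
  qed (simp add: c_def)
  \<comment> \<open>Only \<open>e\<close> is assumed to lie outside \<open>M\<close>: for
    \<open>f\<close> this follows, because \<open>h\<close> never takes the value 1.\<close>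
  have c_inj: "e = f" if "e \<in> edges G - M" "f \<in> edges G" "c e = c f" for e f
  proof -
    have "f \<in> edges G - M"
      using that c_M[of e] c_M[of f] by auto
    then show ?thesis
      using that bij_betw_imp_inj_on[OF h] by (simp add: c_def inj_on_def)
  qed
  have "edges G = M \<union> (edges G - M)"
    using ME by auto
  then have "c ` edges G = c ` M \<union> c ` (edges G - M)"
    by (metis image_Un)
  also have "c ` M = {1}"
    using \<open>M \<noteq> {}\<close> by (auto simp: c_def)
  also have "c ` (edges G - M) = {2..k}"
    using h by (auto simp: c_def bij_betw_def image_def)
  also have "{1} \<union> {2..k} = {1..k}"
    by (auto simp: k_def)
  finally have range: "c ` edges G = {1..k}" .
  have "c e \<noteq> c f" if "e \<in> edges G" "f \<in> edges G" "e \<noteq> f" "e \<inter> f \<noteq> {}" for e f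
    using that c_M c_inj[of e f] c_inj[of f e] perfect_matching_disjoint[OF G M, of e f]
    by (metis Diff_iff disjoint_iff)
  then have proper: "proper_edge_coloring G k c"
    using range by (auto simp: proper_edge_coloring_def)
  have "inj_on (edge_color_code G k c) (verts G)"
  proof (rule inj_onI, rule ccontr)
    fix u v assume uv: "u \<in> verts G" "v \<in> verts G" "u \<noteq> v"
      and eq: "edge_color_code G k c u = edge_color_code G k c v"
    have dist: "class_dist G u {f} = class_dist G v {f}" if "f \<in> edges G - M" for f
    proof -
      have "color_class G c (c f) = {f}"
        using that c_inj[OF that _ sym] unfolding color_class_def by blast
      then show ?thesis
        using eq range that unfolding edge_color_code_eq_iff by (metis Diff_iff imageI)
    qed
    have "graph_order G \<le> 4"
    proof (rule matching_twins_order_le_4[OF G conn M uv])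
      fix f assume f: "f \<in> edges G - M"
      \<comment> \<open>For the class \<open>{f}\<close>, an entry below 1 means incidence with
        \<open>f\<close>, and an entry below 2 means that \<open>f\<close> contains the vertex or
        one of its neighbours.\<close>
      show "u \<in> f \<longleftrightarrow> v \<in> f"
        using dist[OF f] uv(1,2)[THEN class_dist_less_1_iff, of "{f}"] by simp
      show "(u \<in> f \<or> (\<exists>x\<in>f. {u, x} \<in> edges G)) \<longleftrightarrow> (v \<in> f \<or> (\<exists>x\<in>f. {v, x} \<in> edges G))"
        using dist[OF f] uv(1,2)[THEN class_dist_less_2_iff, of "{f}"] sub[of f] f by simp
    qed
    then show False using order by simp
  qed
  then show ?thesis
    using proper unfolding edge_locating_coloring_def k_def by blast
qed

lemma edge_locating_chromatic_number_le:
  assumes G: "fin_simple_graph G" and "connected_graph G" "graph_order G \<ge> 5"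
    and M: "perfect_matching G M"
  shows "ereal_of_enat (edge_locating_chromatic_number G)
    \<le> ereal (real (graph_size G) - real (graph_order G) / 2 + 1)"
proof -
  let ?k = "card (edges G - M) + 1"
  have "edge_locating_chromatic_number G \<le> enat ?k"
    using edge_locating_coloring_perfect_matching[OF assms]
    by (auto simp: edge_locating_chromatic_number_def intro!: Inf_lower)
  then have "ereal_of_enat (edge_locating_chromatic_number G) \<le> ereal_of_enat (enat ?k)"
    by (simp only: ereal_of_enat_le_iff)
  also have "\<dots> = ereal (real ?k)"
    by simp
  also have "real ?k = real (graph_size G) - real (graph_order G) / 2 + 1"
  proof -
    note fin = finite_edges[OF G]
    have ME: "M \<subseteq> edges G"
      using M by (simp add: perfect_matching_def)
    \<comment> \<open>This keeps the truncated subtraction of naturals exact when it is moved to the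
      reals.\<close>
    have "card M \<le> card (edges G)"
      using card_mono[OF fin ME] .
    then have "real (card (edges G - M)) = real (card (edges G)) - real (card M)"
      using card_Diff_subset[OF finite_subset[OF ME fin] ME] by simp
    moreover have "real (card M) = real (graph_order G) / 2"
      using card_perfect_matching[OF G M] by (metis nonzero_mult_div_cancel_left of_nat_mult
          of_nat_numeral zero_neq_numeral)
    ultimately show ?thesis
      by (simp add: graph_size_def)
  qed
  finally show ?thesis .
qed

section \<open>Lower bounds from distances 0 and 1\<close>

lemma edge_locating_chromatic_number_ge:
  assumes "\<And>k c. edge_locating_coloring G k c \<Longrightarrow> b \<le> k"
  shows "ereal (real b) \<le> ereal_of_enat (edge_locating_chromatic_number G)"
proof -
  have "enat b \<le> edge_locating_chromatic_number G"
    using assms by (auto simp: edge_locating_chromatic_number_def intro!: Inf_greatest)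
  then have "ereal_of_enat (enat b) \<le> ereal_of_enat (edge_locating_chromatic_number G)"
    by (simp only: ereal_of_enat_le_iff)
  then show ?thesis
    by simp
qed

text \<open>\<open>near\<close> confines all entries of both codes to 0 and 1, and
  \<open>same\<close> puts the zeros in the same positions. The codes are then equal, and
  injectivity applies.\<close>

lemma edge_locating_coloring_separates:
  assumes G: "fin_simple_graph G" and c: "edge_locating_coloring G k c"
    and uv: "u \<in> verts G" "v \<in> verts G"
    and same: "{c e |e. e \<in> edges G \<and> u \<in> e} = {c e |e. e \<in> edges G \<and> v \<in> e}"
    and near: "\<And>w i. w \<in> {u, v} \<Longrightarrow> i \<in> {1..k} \<Longrightarrow>
      \<exists>e\<in>edges G. c e = i \<and> (w \<in> e \<or> (\<exists>x\<in>e. {w, x} \<in> edges G))"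
  shows "u = v"
proof -
  have sub: "\<Union>(color_class G c i) \<subseteq> verts G" for i
    using G by (auto simp: fin_simple_graph_def color_class_def)
  have "edge_color_code G k c u = edge_color_code G k c v"
    unfolding edge_color_code_eq_iff
  proof
    fix i assume i: "i \<in> {1..k}"
    have "class_dist G w (color_class G c i) < 2" if "w \<in> {u, v}" for w
      using near[OF that i] that uv class_dist_less_2_iff[OF _ sub]
      by (auto simp: color_class_def)
    moreover have "class_dist G w (color_class G c i) < 1
        \<longleftrightarrow> i \<in> {c e |e. e \<in> edges G \<and> w \<in> e}" if "w \<in> {u, v}" for w
      using that uv class_dist_less_1_iff[of w G] by (auto simp: color_class_def)
    ultimately show "class_dist G u (color_class G c i) = class_dist G v (color_class G c i)"
      using same by (intro enat_eq_of_less_2) auto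
  qed
  then show ?thesis
    using c uv by (auto simp: edge_locating_coloring_def inj_on_def)
qed

text \<open>With at most two colours, the two edges at \<open>u\<close> already show every colour,
  and so do those at \<open>v\<close>; both codes would consist of zeros.\<close>

lemma edge_locating_coloring_ge_3:
  assumes G: "fin_simple_graph G" and c: "edge_locating_coloring G k c"
    and uv: "u \<in> verts G" "v \<in> verts G" "u \<noteq> v"
    and u: "e1 \<in> edges G" "e2 \<in> edges G" "e1 \<noteq> e2" "u \<in> e1" "u \<in> e2"
    and v: "f1 \<in> edges G" "f2 \<in> edges G" "f1 \<noteq> f2" "v \<in> f1" "v \<in> f2"
  shows "3 \<le> k"
proof (rule ccontr)
  assume k: "\<not> 3 \<le> k"
  have c_range: "c ` edges G = {1..k}"
    and c_proper: "\<And>e f. e \<in> edges G \<Longrightarrow> f \<in> edges G \<Longrightarrow> e \<noteq> f \<Longrightarrow> e \<inter> f \<noteq> {} \<Longrightarrow> c e \<noteq> c f"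
    using c by (auto simp: edge_locating_coloring_def proper_edge_coloring_def)
  have all: "{c e |e. e \<in> edges G \<and> w \<in> e} = {1..k}"
    if "g1 \<in> edges G" "g2 \<in> edges G" "g1 \<noteq> g2" "w \<in> g1" "w \<in> g2" for w g1 g2
  proof (rule card_seteq)
    show "{c e |e. e \<in> edges G \<and> w \<in> e} \<subseteq> {1..k}"
      using c_range by auto
    then have "card {c g1, c g2} \<le> card {c e |e. e \<in> edges G \<and> w \<in> e}"
      using that by (intro card_mono) (auto intro: finite_subset)
    moreover have "c g1 \<noteq> c g2"
      using c_proper that by blast
    ultimately show "card {1..k} \<le> card {c e |e. e \<in> edges G \<and> w \<in> e}"
      using k by simp
  qed simp
  note all_u = all[OF u] and all_v = all[OF v]
  have "\<exists>e\<in>edges G. c e = i \<and> (w \<in> e \<or> (\<exists>x\<in>e. {w, x} \<in> edges G))"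
    if "w \<in> {u, v}" "i \<in> {1..k}" for w i
  proof -
    have "i \<in> {c e |e. e \<in> edges G \<and> w \<in> e}"
      using that all_u all_v by auto
    then show ?thesis
      by blast
  qed
  then show False
    using edge_locating_coloring_separates[OF G c uv(1,2)] all_u all_v uv(3) by simp
qed

section \<open>The cycle and the path on six vertices\<close>

lemma successively_upt: "successively (\<lambda>x y. y = Suc x) [m..<n]"
  by (induction n) (auto simp: successively_append_iff le_less)

text \<open>Intervals of consecutive numbers are walks upwards, and their reversals are walks
  downwards.\<close>

lemma connected_graph_lessThan:
  assumes V: "verts G = {..<n::nat}" "n > 0"
    and E: "\<And>i. Suc i < n \<Longrightarrow> {i, Suc i} \<in> edges G"
  shows "connected_graph G"
proof -
  have up: "walk_betw G u [u..<Suc v] v" if "u \<le> v" "v < n" for u v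
  proof -
    have "successively (\<lambda>x y. {x, y} \<in> edges G) [u..<Suc v]"
      using successively_upt by (rule successively_mono) (use that E in auto)
    moreover have "set [u..<Suc v] \<subseteq> verts G"
      using that V by force
    ultimately show ?thesis
      using that by (simp add: walk_betw_def del: upt_Suc)
  qed
  have down: "walk_betw G v (rev [u..<Suc v]) u" if "u \<le> v" "v < n" for u v
    using up[OF that] unfolding walk_betw_def
    by (simp only: successively_rev set_rev rev_is_Nil_conv hd_rev last_rev)
      (simp add: insert_commute)
  show ?thesis
    using V up down unfolding connected_graph_def by (metis empty_iff lessThan_iff nat_le_linear)
qed

lemma edges_cycle_6:
  "edges (cycle_graph 6) = {{0, 1}, {1, 2}, {2, 3}, {3, 4}, {4, 5}, {0, 5}}"
proof -
  have "{i :: nat. i < 6} = {0, 1, 2, 3, 4, 5}"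
    by auto
  moreover have "edges (cycle_graph 6) = (\<lambda>i. {i, (i + 1) mod 6}) ` {i. i < 6}"
    by (auto simp: cycle_graph_def)
  ultimately show ?thesis
    \<comment> \<open>\<open>insert_commute\<close> identifies the closing edge
      \<open>{5, 0}\<close> with \<open>{0, 5}\<close>; the flipped equations turn
      \<open>Suc\<close> terms back into numerals.\<close>
    by (simp add: insert_commute flip: One_nat_def numeral_2_eq_2)
qed

lemma edges_path_6:
  "edges (path_graph 6) = {{0, 1}, {1, 2}, {2, 3}, {3, 4}, {4, 5}}"
proof -
  have "{i :: nat. i + 1 < 6} = {0, 1, 2, 3, 4}"
    by auto
  moreover have "edges (path_graph 6) = (\<lambda>i. {i, i + 1}) ` {i. i + 1 < 6}"
    by (auto simp: path_graph_def)
  ultimately show ?thesis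
    by (simp flip: One_nat_def numeral_2_eq_2)
qed

lemma verts_cycle [simp]: "verts (cycle_graph n) = {..<n}"
  and verts_path [simp]: "verts (path_graph n) = {..<n}"
  by (simp_all add: cycle_graph_def path_graph_def)

lemma lessThan_6: "{..<6::nat} = {0, 1, 2, 3, 4, 5}"
  by auto

lemma fin_simple_graph_examples:
  "fin_simple_graph (cycle_graph 6)" "fin_simple_graph (path_graph 6)"
  by (auto simp: fin_simple_graph_def edges_cycle_6 edges_path_6)

lemma connected_graph_examples:
  "connected_graph (cycle_graph 6)" "connected_graph (path_graph 6)"
proof -
  have "{i, Suc i} \<in> edges (cycle_graph 6)" if "Suc i < 6" for i
    using that by (auto simp: cycle_graph_def intro!: exI[of _ i])
  then show "connected_graph (cycle_graph 6)"
    by (intro connected_graph_lessThan[of _ 6]) auto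
  have "{i, Suc i} \<in> edges (path_graph 6)" if "Suc i < 6" for i
    using that by (auto simp: path_graph_def)
  then show "connected_graph (path_graph 6)"
    by (intro connected_graph_lessThan[of _ 6]) auto
qed

lemma perfect_matching_examples:
  "perfect_matching (cycle_graph 6) {{0, 1}, {2, 3}, {4, 5}}"
  "perfect_matching (path_graph 6) {{0, 1}, {2, 3}, {4, 5}}"
  by (rule perfect_matchingI;
      auto simp: edges_cycle_6 edges_path_6 lessThan_6 pairwise_def disjnt_def)+

lemma graph_order_examples:
  "graph_order (cycle_graph 6) = 6" "graph_order (path_graph 6) = 6"
  by (simp_all add: graph_order_def)

lemma graph_size_examples:
  "graph_size (cycle_graph 6) = 6" "graph_size (path_graph 6) = 5"
  by (simp_all add: graph_size_def edges_cycle_6 edges_path_6 doubleton_eq_iff)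

section \<open>Sharpness for the two examples\<close>

text \<open>The inner vertices 1 and 2 both have degree two, which already forces the value 5 - 6/2
  + 1 = 3.\<close>

lemma edge_locating_coloring_path_6:
  assumes "edge_locating_coloring (path_graph 6) k c"
  shows "3 \<le> k"
  by (rule edge_locating_coloring_ge_3[OF fin_simple_graph_examples(2) assms,
        of 1 2 "{0, 1}" "{1, 2}" "{1, 2}" "{2, 3}"])
    (auto simp: edges_path_6 doubleton_eq_iff)

text \<open>In a cyclic sequence of edge colours, vertex \<open>j\<close> sees \<open>a\<^sub>j\<^sub>-\<^sub>1\<close> and \<open>a\<^sub>j\<close>, and has distance at most
  1 to the colours \<open>a\<^sub>j\<^sub>-\<^sub>2\<close>, \<dots>, \<open>a\<^sub>j\<^sub>+\<^sub>1\<close>. If consecutive colours differ and there are three colours in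
  total, these four colours are all of them unless they alternate.\<close>

definition windows_collide :: "'a \<Rightarrow> 'a \<Rightarrow> 'a \<Rightarrow> 'a \<Rightarrow> 'a \<Rightarrow> 'a \<Rightarrow> 'a \<Rightarrow> 'a \<Rightarrow> bool" where
  "windows_collide p q r s p' q' r' s' \<longleftrightarrow>
    (q = q' \<and> r = r' \<or> q = r' \<and> r = q') \<and> (p \<noteq> r \<or> q \<noteq> s) \<and> (p' \<noteq> r' \<or> q' \<noteq> s')"

text \<open>Here \<open>x, y, c, d, e, f\<close> are the colours of the edges around the hexagon.
  The disjuncts compare the three pairs of opposite vertices and the six pairs of adjacent ones.
  Calling the first two colours \<open>x\<close> and \<open>y\<close> leaves at most four choices
  each for \<open>(c, d)\<close> and \<open>(e, f)\<close>, and every admissible combination has a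
  collision.\<close>

lemma hexagon_windows_collide:
  assumes ne: "x \<noteq> y" "x \<noteq> z" "y \<noteq> z"
    and mem: "c \<in> {x, y, z}" "d \<in> {x, y, z}" "e \<in> {x, y, z}" "f \<in> {x, y, z}"
    and proper: "y \<noteq> c" "c \<noteq> d" "d \<noteq> e" "e \<noteq> f" "f \<noteq> x"
    and z: "z \<in> {c, d, e, f}"
  shows "windows_collide x y c d d e f x \<or> windows_collide y c d e e f x y \<or>
    windows_collide c d e f f x y c \<or> windows_collide x y c d y c d e \<or>
    windows_collide y c d e c d e f \<or> windows_collide c d e f d e f x \<or>
    windows_collide d e f x e f x y \<or> windows_collide e f x y f x y c \<or>
    windows_collide f x y c x y c d"
proof -
  note ne' = ne ne[symmetric]
  have cd: "c = x \<and> d = y \<or> c = x \<and> d = z \<or> c = z \<and> d = x \<or> c = z \<and> d = y"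
    using mem(1,2) proper(1,2) by auto
  have ef: "f = y \<and> e = x \<or> f = y \<and> e = z \<or> f = z \<and> e = x \<or> f = z \<and> e = y"
    using mem(3,4) proper(4,5) by auto
  from cd ef proper(3) z show ?thesis
    by (elim disjE conjE; simp only: windows_collide_def ne' simp_thms insert_iff empty_iff)
qed

lemma cyclic_three_coloring_collision:
  fixes a :: "nat \<Rightarrow> nat"
  assumes range: "{a 0, a 1, a 2, a 3, a 4, a 5} = {1, 2, 3}"
    and proper: "\<And>i. i < 6 \<Longrightarrow> a i \<noteq> a ((i + 1) mod 6)"
  shows "\<exists>u<6. \<exists>v<6. u \<noteq> v \<and>
    {a ((u + 5) mod 6), a u} = {a ((v + 5) mod 6), a v} \<and>
    (\<forall>w\<in>{u, v}. {1, 2, 3} \<subseteq> {a ((w + 4) mod 6), a ((w + 5) mod 6), a w, a ((w + 1) mod 6)})"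
proof -
  \<comment> \<open>Modulo 6, adding 4 and 5 means subtracting 2 and 1, which avoids truncated
    subtraction.\<close>
  define collide where "collide u v \<longleftrightarrow>
    windows_collide (a ((u + 4) mod 6)) (a ((u + 5) mod 6)) (a u) (a ((u + 1) mod 6))
      (a ((v + 4) mod 6)) (a ((v + 5) mod 6)) (a v) (a ((v + 1) mod 6))" for u v
  have neq: "a 0 \<noteq> a 1" "a 1 \<noteq> a 2" "a 2 \<noteq> a 3" "a 3 \<noteq> a 4" "a 4 \<noteq> a 5" "a 5 \<noteq> a 0"
    using proper[of 0] proper[of 1] proper[of 2] proper[of 3] proper[of 4] proper[of 5]
    by (simp_all flip: numeral_2_eq_2)
  \<comment> \<open>Now \<open>z\<close> is obtained as the one colour that differs from
    \<open>a 0\<close> and \<open>a 1\<close>.\<close>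
  have sub: "{a 0, a 1} \<subseteq> {1, 2, 3}"
    unfolding range[symmetric] by simp
  then have "card ({1, 2, 3} - {a 0, a 1}) = 1"
    using neq(1) by (subst card_Diff_subset) simp_all
  then obtain z where "{1, 2, 3} - {a 0, a 1} = {z}"
    by (rule card_1_singletonE)
  then have z: "{1, 2, 3} = {a 0, a 1, z}" "a 0 \<noteq> z" "a 1 \<noteq> z"
    using sub by blast+
  have "z \<in> {a 0, a 1, a 2, a 3, a 4, a 5}"
    unfolding range z(1) by simp
  then have z_mem: "z \<in> {a 2, a 3, a 4, a 5}"
    using z(2,3) by simp
  have "a 2 \<in> {a 0, a 1, z}" "a 3 \<in> {a 0, a 1, z}" "a 4 \<in> {a 0, a 1, z}" "a 5 \<in> {a 0, a 1, z}"
    unfolding z(1)[symmetric] range[symmetric] by simp_all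
  note hexagon_windows_collide[OF neq(1) z(2,3) this neq(2-6) z_mem]
  then have "collide 2 5 \<or> collide 3 0 \<or> collide 4 1 \<or> collide 2 3 \<or> collide 3 4 \<or> collide 4 5
      \<or> collide 5 0 \<or> collide 0 1 \<or> collide 1 2"
    by (simp add: collide_def flip: numeral_2_eq_2)
  then obtain u v where uv: "u < 6" "v < 6" "u \<noteq> v" and collide: "collide u v"
    by (elim disjE) (rule that; simp)+
  have range': "a i \<in> {1, 2, 3}" if "i < 6" for i
  proof -
    have "a ` {..<6} = {1, 2, 3}"
      using range unfolding lessThan_6 by simp
    then show ?thesis
      using that by blast
  qed
  have three: "{1, 2, 3} = {p, q, r}"
    if "p \<in> {1, 2, 3}" "q \<in> {1, 2, 3}" "r \<in> {1, 2, 3}" "p \<noteq> q" "q \<noteq> r" "p \<noteq> r" for p q r :: nat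
    using that card_seteq[of "{1, 2, 3}" "{p, q, r}"] by simp
  have near: "{1, 2, 3} \<subseteq> {a ((w + 4) mod 6), a ((w + 5) mod 6), a w, a ((w + 1) mod 6)}"
    if w: "w < 6"
      and ne: "a ((w + 4) mod 6) \<noteq> a w \<or> a ((w + 5) mod 6) \<noteq> a ((w + 1) mod 6)" for w
  proof -
    have step: "((w + 4) mod 6 + 1) mod 6 = (w + 5) mod 6" "((w + 5) mod 6 + 1) mod 6 = w"
      using w by presburger+
    have neq: "a ((w + 4) mod 6) \<noteq> a ((w + 5) mod 6)" "a ((w + 5) mod 6) \<noteq> a w"
      "a w \<noteq> a ((w + 1) mod 6)"
      using proper[of "(w + 4) mod 6"] proper[of "(w + 5) mod 6"] proper[OF w] step by simp_all
    have mem: "a (i mod 6) \<in> {1, 2, 3}" for i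
      using range' by simp
    \<comment> \<open>Consecutive colours differ, so the first three entries of the window are all
      three colours in one case, and the last three in the other.\<close>
    from ne show ?thesis
    proof
      assume "a ((w + 4) mod 6) \<noteq> a w"
      then show ?thesis
        using three[OF mem mem range'[OF w] neq(1,2)] by blast
    next
      assume "a ((w + 5) mod 6) \<noteq> a ((w + 1) mod 6)"
      then show ?thesis
        using three[OF mem range'[OF w] mem neq(2,3)] by blast
    qed
  qed
  have same: "{a ((u + 5) mod 6), a u} = {a ((v + 5) mod 6), a v}"
    using collide unfolding collide_def windows_collide_def doubleton_eq_iff by blast
  have all: "\<forall>w\<in>{u, v}.
      {1, 2, 3} \<subseteq> {a ((w + 4) mod 6), a ((w + 5) mod 6), a w, a ((w + 1) mod 6)}"
  proof
    fix w assume "w \<in> {u, v}"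
    then have "w = u \<or> w = v"
      by simp
    then show "{1, 2, 3} \<subseteq> {a ((w + 4) mod 6), a ((w + 5) mod 6), a w, a ((w + 1) mod 6)}"
      using near uv(1,2) collide unfolding collide_def windows_collide_def by metis
  qed
  show ?thesis
    by (rule exI[of _ u], rule conjI[OF uv(1)], rule exI[of _ v])
      (intro conjI uv same all)
qed

text \<open>Two vertices of degree two force three colours, so a counterexample has
  \<open>k = 3\<close>. The collision in the cyclic colour sequence then yields two distinct
  vertices with equal codes.\<close>

lemma edge_locating_coloring_cycle_6:
  assumes c: "edge_locating_coloring (cycle_graph 6) k c"
  shows "4 \<le> k"
proof (rule ccontr)
  assume "\<not> 4 \<le> k"
  moreover have "3 \<le> k"
    by (rule edge_locating_coloring_ge_3[OF fin_simple_graph_examples(1) c,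
          of 1 2 "{0, 1}" "{1, 2}" "{1, 2}" "{2, 3}"])
      (auto simp: edges_cycle_6 doubleton_eq_iff)
  ultimately have k: "{1..k} = {1, 2, 3}"
    by auto
  define E where "E j = {j, (j + 1) mod 6}" for j :: nat
  define a where "a j = c (E j)" for j
  have edges: "edges (cycle_graph 6) = E ` {..<6}"
    by (auto simp: cycle_graph_def E_def)
  have range: "c ` edges (cycle_graph 6) = {1, 2, 3}"
    and proper: "\<And>e f. e \<in> edges (cycle_graph 6) \<Longrightarrow> f \<in> edges (cycle_graph 6) \<Longrightarrow> e \<noteq> f \<Longrightarrow>
      e \<inter> f \<noteq> {} \<Longrightarrow> c e \<noteq> c f"
    using c k by (auto simp: edge_locating_coloring_def proper_edge_coloring_def)
  \<comment> \<open>Edge \<open>E j\<close> joins \<open>j\<close> to its successor, so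
    \<open>w\<close> lies on \<open>E w\<close> and on the edge before it.\<close>
  have incident: "w \<in> E j \<longleftrightarrow> j = w \<or> j = (w + 5) mod 6" if "w < 6" "j < 6" for w j
  proof -
    have "(j + 1) mod 6 = (if j = 5 then 0 else j + 1)"
      using that by (simp add: mod_Suc)
    moreover have "(w + 5) mod 6 = (if w = 0 then 5 else w - 1)"
      using that by (cases w) simp_all
    ultimately show ?thesis
      using that by (auto simp: E_def)
  qed
  have "a ` {..<6} = {1, 2, 3}"
    using range unfolding edges a_def image_image .
  then have "{a 0, a 1, a 2, a 3, a 4, a 5} = {1, 2, 3}"
    unfolding lessThan_6 by simp
  moreover have "a j \<noteq> a ((j + 1) mod 6)" if j: "j < 6" for j
    unfolding a_def
  proof (rule proper)
    let ?j' = "(j + 1) mod 6"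
    show "E j \<in> edges (cycle_graph 6)" "E ?j' \<in> edges (cycle_graph 6)"
      using j by (auto simp: edges)
    \<comment> \<open>Consecutive edges are distinct because \<open>j\<close> lies on the first one
      only.\<close>
    have "j \<noteq> ?j'" "j \<noteq> (?j' + 1) mod 6"
      using j by presburger+
    then have "j \<notin> E ?j'" "j \<in> E j"
      by (simp_all add: E_def)
    then show "E j \<noteq> E ?j'"
      by blast
    show "E j \<inter> E ?j' \<noteq> {}"
      by (auto simp: E_def)
  qed
  ultimately have "\<exists>u<6. \<exists>v<6. u \<noteq> v \<and>
      {a ((u + 5) mod 6), a u} = {a ((v + 5) mod 6), a v} \<and>
      (\<forall>w\<in>{u, v}. {1, 2, 3} \<subseteq> {a ((w + 4) mod 6), a ((w + 5) mod 6), a w, a ((w + 1) mod 6)})"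
    by (rule cyclic_three_coloring_collision)
  then obtain u v where uv: "u < 6" "v < 6" "u \<noteq> v"
    and same: "{a ((u + 5) mod 6), a u} = {a ((v + 5) mod 6), a v}"
    and near: "\<forall>w\<in>{u, v}.
      {1, 2, 3} \<subseteq> {a ((w + 4) mod 6), a ((w + 5) mod 6), a w, a ((w + 1) mod 6)}"
    by (elim exE conjE) (rule that)
  have seen: "{c e |e. e \<in> edges (cycle_graph 6) \<and> w \<in> e} = {a ((w + 5) mod 6), a w}"
    if w: "w < 6" for w
  proof -
    have "{c e |e. e \<in> edges (cycle_graph 6) \<and> w \<in> e} = a ` {j. j < 6 \<and> w \<in> E j}"
      by (auto simp: edges a_def)
    also have "{j. j < 6 \<and> w \<in> E j} = {(w + 5) mod 6, w}"
      using incident[OF w] w by auto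
    finally show ?thesis
      by simp
  qed
  have close: "\<exists>e\<in>edges (cycle_graph 6). c e = a j \<and>
      (w \<in> e \<or> (\<exists>x\<in>e. {w, x} \<in> edges (cycle_graph 6)))"
    if w: "w < 6" and "j \<in> {(w + 4) mod 6, (w + 5) mod 6, w, (w + 1) mod 6}" for w j
  proof -
    have j: "j < 6"
      using that by auto
    \<comment> \<open>The edges at index \<open>w\<close> and the index before contain
      \<open>w\<close>; the two outer edges are reached through the neighbours
      \<open>(w + 5) mod 6\<close> and \<open>(w + 1) mod 6\<close>.\<close>
    have "((w + 4) mod 6 + 1) mod 6 = (w + 5) mod 6" "((w + 5) mod 6 + 1) mod 6 = w"
      using w by presburger+
    then have "(w + 5) mod 6 \<in> E ((w + 4) mod 6)" "{w, (w + 5) mod 6} = E ((w + 5) mod 6)"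
      by (auto simp: E_def)
    moreover have "(w + 1) mod 6 \<in> E ((w + 1) mod 6)" "{w, (w + 1) mod 6} = E w"
      by (simp_all add: E_def)
    ultimately have "w \<in> E j \<or> (\<exists>x\<in>E j. \<exists>i<6. {w, x} = E i)"
      using that(2) incident[OF w j] w
      by (elim insertE emptyE) (metis mod_less_divisor zero_less_numeral)+
    then show ?thesis
      using j by (intro bexI[of _ "E j"]) (auto simp: edges a_def)
  qed
  have "u = v"
  proof (rule edge_locating_coloring_separates[OF fin_simple_graph_examples(1) c])
    show "{c e |e. e \<in> edges (cycle_graph 6) \<and> u \<in> e}
        = {c e |e. e \<in> edges (cycle_graph 6) \<and> v \<in> e}"
      using seen uv same by simp
    show "\<exists>e\<in>edges (cycle_graph 6). c e = i \<and>
        (w \<in> e \<or> (\<exists>x\<in>e. {w, x} \<in> edges (cycle_graph 6)))"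
      if w: "w \<in> {u, v}" and i: "i \<in> {1..k}" for w i
    proof -
      have "w < 6"
        using w uv by auto
      moreover obtain j where "i = a j" "j \<in> {(w + 4) mod 6, (w + 5) mod 6, w, (w + 1) mod 6}"
        using bspec[OF near w] i unfolding k by blast
      ultimately show ?thesis
        using close by blast
    qed
  qed (use uv in auto)
  then show False
    using uv by simp
qed

theorem theorem13:
  shows "(\<forall>G :: 'a graph.
      fin_simple_graph G \<and> connected_graph G \<and> graph_order G \<ge> 5 \<and>
      (\<exists>M. perfect_matching G M) \<longrightarrow>
      ereal_of_enat (edge_locating_chromatic_number G)
        \<le> ereal (real (graph_size G) - real (graph_order G) / 2 + 1)) \<and>
    (\<forall>G \<in> {cycle_graph 6, path_graph 6}.
      fin_simple_graph G \<and> connected_graph G \<and> graph_order G \<ge> 5 \<and>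
      (\<exists>M. perfect_matching G M) \<and>
      ereal_of_enat (edge_locating_chromatic_number G)
        = ereal (real (graph_size G) - real (graph_order G) / 2 + 1))"
proof (intro conjI allI impI ballI)
  fix G :: "'a graph"
  assume "fin_simple_graph G \<and> connected_graph G \<and> graph_order G \<ge> 5 \<and>
      (\<exists>M. perfect_matching G M)"
  then show "ereal_of_enat (edge_locating_chromatic_number G)
        \<le> ereal (real (graph_size G) - real (graph_order G) / 2 + 1)"
    using edge_locating_chromatic_number_le by blast
next
  fix G :: "nat graph" assume G: "G \<in> {cycle_graph 6, path_graph 6}"
  show simple: "fin_simple_graph G" and conn: "connected_graph G" and order: "graph_order G \<ge> 5"
    and pm: "\<exists>M. perfect_matching G M"
    using G fin_simple_graph_examples connected_graph_examples perfect_matching_examples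
      graph_order_examples by auto
  show "ereal_of_enat (edge_locating_chromatic_number G)
        = ereal (real (graph_size G) - real (graph_order G) / 2 + 1)"
  proof (rule antisym)
    show "ereal_of_enat (edge_locating_chromatic_number G)
        \<le> ereal (real (graph_size G) - real (graph_order G) / 2 + 1)"
      using edge_locating_chromatic_number_le simple conn order pm by blast
    show "ereal (real (graph_size G) - real (graph_order G) / 2 + 1)
        \<le> ereal_of_enat (edge_locating_chromatic_number G)"
      \<comment> \<open>The bound evaluates to 6 - 3 + 1 = 4 for the cycle and 5 - 3 + 1 = 3 for the
        path.\<close>
      using G edge_locating_chromatic_number_ge[of "cycle_graph 6" 4, OF edge_locating_coloring_cycle_6]
        edge_locating_chromatic_number_ge[of "path_graph 6" 3, OF edge_locating_coloring_path_6]
      by (auto simp: graph_order_examples graph_size_examples)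
  qed
qed

end
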